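(* Let $(C,d)$ be a metric space with diameter at most $2$, let $x_0$ be a point, and let $X=\mathcal{C}_{x_0}([0,1],C)$ be the cone over $C$ with apex $x_0$. Define $D:X\times X\to\mathbb{R}_{\ge 0}$ by $D(x_0,x_0)=0$, $D((a,c_1),x_0)=D(x_0,(a,c_1))=a$ and $D((a,c_1),(b,c_2))=|a-b|+\min(a,b)\,d(c_1,c_2)$ for all $a,b\in(0,1]$ and $c_1,c_2\in C$. Then $D$ is a metric on $X$ preserving the topology of $X$ (that is, $D$ induces the topology of the cone $X$). Moreover, the family $\{F(\alpha)\}_{\alpha\in[0,1]}$ of maps $X\to X$ defined by $F(\alpha)(x_0)=x_0$ and $F(\alpha)(a,c)=(a\alpha,c)$ for $\alpha\in(0,1]$, $(a,c)\in(0,1]\times C$, and by $F(0)(x)=x_0$ for all $x\in X$, is a linear dilation family on $(X,D,x_0)$. Furthermore, the topological boundary in $X$ of the open ball $B_D(x_0;1)=\{x\in X: D(x,x_0)<1\}$ is $\{1\}\times C$.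
   Context: Cone: for a topological space $C$, a set $I\subset\mathbb{R}$ containing $0$, and a point $p$, $\mathcal{C}_p(I,C)$ denotes the cone formed from $I\times C$ by identifying $\{0\}\times C$ with $p$; its points other than $p$ are written $(a,c)$ with $a\in I\setminus\{0\}$, $c\in C$. Dilation: a map $h:(X,d_1)\to(Y,d_2)$ of metric spaces is a dilation of scale $\alpha\ge 0$ if $d_2(h(x),h(y))=\alpha\, d_1(x,y)$ for all $x,y\in X$. Dilation family: let $(X,d)$ be a metric space, $x_0\in X$, and $I\subset\mathbb{R}_{\ge 0}$ closed under multiplication. A family $\{T_\alpha\}_{\alpha\in I}$ of maps $X\to X$ is a dilation family on $(X,d,x_0)$ if (1) each $T_\alpha$ is a dilation of scale $\alpha$ with respect to $d$; (2) $T_\alpha(x_0)=x_0$ for all $\alpha\in I$; (3) $T_\alpha\circ T_\beta=T_{\alpha\beta}$ for all $\alpha,\beta\in I$; (4) for every $x\in X$ the limit $\lim_{\alpha\to 1}T_\alpha(x)$ exists. Linear dilation family: a dilation family $\{T_\alpha\}_{\alpha\in I}$ on $(X,d,x_0)$ such that for all $\alpha\le\beta\le\gamma$ in $I$ and all $x\in X$, $d(T_\alpha(x),T_\gamma(x))=d(T_\alpha(x),T_\beta(x))+d(T_\beta(x),T_\gamma(x))$.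
   Formalization: The cone's topology is the quotient topology with the added requirement that neighbourhoods of the apex contain all points of small radius; for non-compact C the plain quotient topology is not induced by D. For compact nonempty C the quotient topology itself is shown to be induced by D. *)

theory Defs
  imports "HOL-Analysis.Analysis"
begin

definition mdiameter :: "'a set \<Rightarrow> ('a \<Rightarrow> 'a \<Rightarrow> real) \<Rightarrow> ennreal" where
  "mdiameter M d = (SUP (x, y) \<in> M \<times> M. ennreal (d x y))"

text \<open>The constructor \<open>Apex\<close> plays the role of the point \<open>x\<^sub>0\<close>, and \<open>Pt a c\<close> that of the
  point \<open>(a, c)\<close> with \<open>a \<noteq> 0\<close>.\<close>

datatype 'c cone_point = Apex | Pt real 'c

definition cone_space :: "real set \<Rightarrow> 'c set \<Rightarrow> 'c cone_point set" where
  "cone_space I C = insert Apex {Pt a c |a c. a \<in> I - {0} \<and> c \<in> C}"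

text \<open>The identification map \<open>I \<times> C \<rightarrow> cone_space I C\<close> collapsing \<open>{0} \<times> C\<close> to the apex.\<close>

definition cone_proj :: "real \<times> 'c \<Rightarrow> 'c cone_point" where
  "cone_proj = (\<lambda>(a, c). if a = 0 then Apex else Pt a c)"

text \<open>A set is open in the cone if its preimage in \<open>I \<times> C\<close> is open and, in case it contains the
  apex, it contains all points with sufficiently small first coordinate. When \<open>C\<close> is compact the
  second condition follows from the first (by the tube lemma) and this is the quotient topology.
  It cannot be dropped in general: if \<open>C\<close> is a non-compact metric space and \<open>I = {0..1}\<close>, the
  quotient topology is not first countable at the apex, so it is not induced by any metric.\<close>

definition cone_topology :: "real set \<Rightarrow> 'c topology \<Rightarrow> 'c cone_point topology" where
  "cone_topology I T = topology (\<lambda>U. U \<subseteq> cone_space I (topspace T) \<and>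
     openin (prod_topology (top_of_set I) T) {z \<in> I \<times> topspace T. cone_proj z \<in> U} \<and>
     (Apex \<in> U \<longrightarrow> (\<exists>e>0. \<forall>a\<in>I - {0}. \<forall>c\<in>topspace T. \<bar>a\<bar> < e \<longrightarrow> Pt a c \<in> U)))"

lemma openin_cone_topology:
  "openin (cone_topology I T) U \<longleftrightarrow> U \<subseteq> cone_space I (topspace T) \<and>
     openin (prod_topology (top_of_set I) T) {z \<in> I \<times> topspace T. cone_proj z \<in> U} \<and>
     (Apex \<in> U \<longrightarrow> (\<exists>e>0. \<forall>a\<in>I - {0}. \<forall>c\<in>topspace T. \<bar>a\<bar> < e \<longrightarrow> Pt a c \<in> U))"
proof -
  let ?Z = "\<lambda>U. {z \<in> I \<times> topspace T. cone_proj z \<in> U}"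
  let ?small = "\<lambda>U. \<exists>e>0. \<forall>a\<in>I - {0}. \<forall>c\<in>topspace T. \<bar>a\<bar> < e \<longrightarrow> Pt a c \<in> U"
  let ?P = "\<lambda>U. U \<subseteq> cone_space I (topspace T) \<and>
     openin (prod_topology (top_of_set I) T) (?Z U) \<and> (Apex \<in> U \<longrightarrow> ?small U)"
  have "?P (S \<inter> S')" if S: "?P S" and S': "?P S'" for S S'
  proof -
    have "?Z (S \<inter> S') = ?Z S \<inter> ?Z S'"
      by auto
    then have "openin (prod_topology (top_of_set I) T) (?Z (S \<inter> S'))"
      using S S' by (simp only: openin_Int)
    moreover have "?small (S \<inter> S')" if "Apex \<in> S \<inter> S'"
    proof -
      obtain e e' where "e > 0" "e' > 0"
        and "\<forall>a\<in>I - {0}. \<forall>c\<in>topspace T. \<bar>a\<bar> < e \<longrightarrow> Pt a c \<in> S"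
        and "\<forall>a\<in>I - {0}. \<forall>c\<in>topspace T. \<bar>a\<bar> < e' \<longrightarrow> Pt a c \<in> S'"
        using \<open>Apex \<in> S \<inter> S'\<close> S S' by blast
      then show ?thesis
        by (intro exI[of _ "min e e'"]) simp
    qed
    ultimately show ?thesis
      using S by blast
  qed
  moreover have "?P (\<Union>\<K>)" if \<K>: "\<forall>K\<in>\<K>. ?P K" for \<K>
  proof -
    have "?Z (\<Union>\<K>) = (\<Union>K\<in>\<K>. ?Z K)"
      by auto
    then have "openin (prod_topology (top_of_set I) T) (?Z (\<Union>\<K>))"
      using \<K> by (metis (no_types, lifting) openin_Union imageE)
    moreover have "?small (\<Union>\<K>)" if Apex: "Apex \<in> \<Union>\<K>"
    proof -
      obtain K where "K \<in> \<K>" "Apex \<in> K"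
        using Apex by blast
      then obtain e where "e > 0" "\<forall>a\<in>I - {0}. \<forall>c\<in>topspace T. \<bar>a\<bar> < e \<longrightarrow> Pt a c \<in> K"
        using \<K> by blast
      with \<open>K \<in> \<K>\<close> show ?thesis
        by blast
    qed
    ultimately show ?thesis
      using \<K> by blast
  qed
  ultimately have "istopology ?P"
    unfolding istopology_def by (intro conjI allI impI) simp_all
  then show ?thesis
    by (simp add: cone_topology_def)
qed

text \<open>The distance \<open>D\<close> on the cone \<open>cone_space {0..1} C\<close>. It is set to \<open>0\<close> outside the cone because
  \<^locale>\<open>Metric_space\<close> asks for nonnegativity on the whole type.\<close>

fun cone_dist_formula :: "('c \<Rightarrow> 'c \<Rightarrow> real) \<Rightarrow> 'c cone_point \<Rightarrow> 'c cone_point \<Rightarrow> real" where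
  "cone_dist_formula d Apex Apex = 0"
| "cone_dist_formula d (Pt a c) Apex = a"
| "cone_dist_formula d Apex (Pt a c) = a"
| "cone_dist_formula d (Pt a c) (Pt b c') = \<bar>a - b\<bar> + min a b * d c c'"

definition cone_dist ::
  "'c set \<Rightarrow> ('c \<Rightarrow> 'c \<Rightarrow> real) \<Rightarrow> 'c cone_point \<Rightarrow> 'c cone_point \<Rightarrow> real" where
  "cone_dist C d x y =
     (if x \<in> cone_space {0..1} C \<and> y \<in> cone_space {0..1} C then cone_dist_formula d x y else 0)"

fun cone_scaling :: "real \<Rightarrow> 'c cone_point \<Rightarrow> 'c cone_point" where
  "cone_scaling \<alpha> Apex = Apex"
| "cone_scaling \<alpha> (Pt a c) = (if \<alpha> = 0 then Apex else Pt (a * \<alpha>) c)"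

definition dilation ::
  "'a set \<Rightarrow> ('a \<Rightarrow> 'a \<Rightarrow> real) \<Rightarrow> 'b set \<Rightarrow> ('b \<Rightarrow> 'b \<Rightarrow> real) \<Rightarrow> real \<Rightarrow> ('a \<Rightarrow> 'b) \<Rightarrow> bool" where
  "dilation X d\<^sub>1 Y d\<^sub>2 \<alpha> h \<longleftrightarrow>
     \<alpha> \<ge> 0 \<and> h \<in> X \<rightarrow> Y \<and> (\<forall>x\<in>X. \<forall>y\<in>X. d\<^sub>2 (h x) (h y) = \<alpha> * d\<^sub>1 x y)"

definition dilation_family ::
  "'a set \<Rightarrow> ('a \<Rightarrow> 'a \<Rightarrow> real) \<Rightarrow> 'a \<Rightarrow> real set \<Rightarrow> (real \<Rightarrow> 'a \<Rightarrow> 'a) \<Rightarrow> bool" where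
  "dilation_family X d x\<^sub>0 I T \<longleftrightarrow>
     Metric_space X d \<and> x\<^sub>0 \<in> X \<and> I \<subseteq> {0..} \<and> (\<forall>\<alpha>\<in>I. \<forall>\<beta>\<in>I. \<alpha> * \<beta> \<in> I) \<and>
     (\<forall>\<alpha>\<in>I. dilation X d X d \<alpha> (T \<alpha>)) \<and>
     (\<forall>\<alpha>\<in>I. T \<alpha> x\<^sub>0 = x\<^sub>0) \<and>
     (\<forall>\<alpha>\<in>I. \<forall>\<beta>\<in>I. \<forall>x\<in>X. T \<alpha> (T \<beta> x) = T (\<alpha> * \<beta>) x) \<and>
     (\<forall>x\<in>X. \<exists>l. limitin (Metric_space.mtopology X d) (\<lambda>\<alpha>. T \<alpha> x) l (at 1 within I))"

definition linear_dilation_family ::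
  "'a set \<Rightarrow> ('a \<Rightarrow> 'a \<Rightarrow> real) \<Rightarrow> 'a \<Rightarrow> real set \<Rightarrow> (real \<Rightarrow> 'a \<Rightarrow> 'a) \<Rightarrow> bool" where
  "linear_dilation_family X d x\<^sub>0 I T \<longleftrightarrow>
     dilation_family X d x\<^sub>0 I T \<and>
     (\<forall>\<alpha>\<in>I. \<forall>\<beta>\<in>I. \<forall>\<gamma>\<in>I. \<alpha> \<le> \<beta> \<and> \<beta> \<le> \<gamma> \<longrightarrow>
        (\<forall>x\<in>X. d (T \<alpha> x) (T \<gamma> x) = d (T \<alpha> x) (T \<beta> x) + d (T \<beta> x) (T \<gamma> x)))"

end

theory Submission
  imports Defs
begin

text \<open>The formula |a - b| + min a b * d c c' makes sense on all of [0,1] x C and is compatible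
  with collapsing a = 0 to the apex, so the apex rarely needs separate treatment
  (\<open>D_cone_proj\<close>). Only the triangle inequality uses the diameter bound
  (\<open>cone_triangle_formula\<close>). If the intermediate radius e is at least min a b, the
  inequalities in the reals and in C add up. If e is smaller, the radial detour has extra length 2 *
  (min a b - e), and since d is at most 2 this pays for the shrunken weight of d. The case e = 0 is
  the route through the apex.

  For the topology, balls about the apex consist of the points of small radius, which is the apex
  condition in \<open>cone_topology\<close>. Elsewhere D is comparable with the product metric: min
  a b is at most 1, and near a point of radius a it is at least a / 2.

  Scaling multiplies both radii by \<alpha>, and the formula is homogeneous in them, so it is a
  dilation. On a single ray the d term vanishes and D is the distance of radii, which gives both
  linearity and the limit at 1. Scaling a point of radius 1 by \<alpha> < 1 moves it into the open
  unit ball, so that ball is dense in the cone and its boundary is its complement.\<close>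

lemma mdiameter_le_iff:
  assumes "0 \<le> r"
  shows "mdiameter M d \<le> ennreal r \<longleftrightarrow> (\<forall>x\<in>M. \<forall>y\<in>M. d x y \<le> r)"
  using assms by (auto simp: mdiameter_def SUP_le_iff ennreal_le_iff)

section \<open>The cone and its projection\<close>

lemma Apex_in_cone_space [simp]: "Apex \<in> cone_space I C"
  by (simp add: cone_space_def)

lemma Pt_in_cone_space_iff [simp]: "Pt a c \<in> cone_space I C \<longleftrightarrow> a \<in> I \<and> a \<noteq> 0 \<and> c \<in> C"
  by (simp add: cone_space_def)

lemma cone_proj_simps [simp]:
  "cone_proj (0, c) = Apex"
  "a \<noteq> 0 \<Longrightarrow> cone_proj (a, c) = Pt a c"
  by (simp_all add: cone_proj_def)

lemma cone_proj_in_cone_space: "a \<in> I \<Longrightarrow> c \<in> C \<Longrightarrow> cone_proj (a, c) \<in> cone_space I C"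
  by (simp add: cone_proj_def)

lemma image_cone_proj:
  assumes "0 \<in> I" "C \<noteq> {}"
  shows "cone_proj ` (I \<times> C) = cone_space I C"
proof
  show "cone_proj ` (I \<times> C) \<subseteq> cone_space I C"
    using cone_proj_in_cone_space by fast
  show "cone_space I C \<subseteq> cone_proj ` (I \<times> C)"
  proof
    fix x
    assume x: "x \<in> cone_space I C"
    show "x \<in> cone_proj ` (I \<times> C)"
    proof (cases x)
      case Apex
      obtain c where "c \<in> C"
        using assms by blast
      with assms Apex show ?thesis
        by (intro image_eqI[where x = "(0, c)"]) simp_all
    next
      case (Pt a c)
      with x show ?thesis
        by (intro image_eqI[where x = "(a, c)"]) simp_all
    qed
  qed
qed

text \<open>By the tube lemma, an open neighbourhood of the slice {0} x C contains a product V x C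
  with V open around 0 when C is compact. The apex condition of \<open>cone_topology\<close> is then
  automatic, which is what identifies that topology with the quotient topology in
  \<open>quotient_map_cone_proj\<close>.\<close>

lemma small_of_open_preimage_cone_proj:
  assumes "compact_space T" "0 \<in> I" "Apex \<in> U"
    and "openin (prod_topology (top_of_set I) T) {z \<in> I \<times> topspace T. cone_proj z \<in> U}"
  shows "\<exists>e>0. \<forall>a\<in>I - {0}. \<forall>c\<in>topspace T. \<bar>a\<bar> < e \<longrightarrow> Pt a c \<in> U"
proof (cases "topspace T = {}")
  case True
  then show ?thesis
    by (intro exI[of _ 1]) simp
next
  case False
  have "\<exists>V W. openin (top_of_set I) V \<and> openin T W \<and> 0 \<in> V \<and> topspace T \<subseteq> W \<and>
      V \<times> W \<subseteq> {z \<in> I \<times> topspace T. cone_proj z \<in> U}"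
    using assms False
    by (intro tube_lemma_right) (auto simp: compact_space_def)
  then obtain V W where V: "openin (top_of_set I) V" "0 \<in> V" and W: "topspace T \<subseteq> W"
    and VW: "V \<times> W \<subseteq> {z \<in> I \<times> topspace T. cone_proj z \<in> U}"
    by blast
  obtain e where "e > 0" and e: "\<And>a. a \<in> I \<Longrightarrow> dist a 0 < e \<Longrightarrow> a \<in> V"
    using V unfolding openin_euclidean_subtopology_iff by metis
  have "Pt a c \<in> U" if "a \<in> I - {0}" "c \<in> topspace T" "\<bar>a\<bar> < e" for a c
  proof -
    have "(a, c) \<in> V \<times> W"
      using that e[of a] W by auto
    with VW that show ?thesis
      by auto
  qed
  with \<open>e > 0\<close> show ?thesis
    by blast
qed

section \<open>The cone metric\<close>

locale cone_over_metric = Metric_space C d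
  for C :: "'c set" and d :: "'c \<Rightarrow> 'c \<Rightarrow> real" +
  assumes diam_le_2: "x \<in> C \<Longrightarrow> y \<in> C \<Longrightarrow> d x y \<le> 2"
begin

abbreviation X :: "'c cone_point set" where
  "X \<equiv> cone_space {0..1} C"

abbreviation D :: "'c cone_point \<Rightarrow> 'c cone_point \<Rightarrow> real" where
  "D \<equiv> cone_dist C d"

lemma D_simps:
  "D Apex Apex = 0"
  "Pt a c \<in> X \<Longrightarrow> D Apex (Pt a c) = a"
  "Pt a c \<in> X \<Longrightarrow> D (Pt a c) Apex = a"
  "Pt a c \<in> X \<Longrightarrow> Pt b c' \<in> X \<Longrightarrow> D (Pt a c) (Pt b c') = \<bar>a - b\<bar> + min a b * d c c'"
  by (simp_all add: cone_dist_def)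

text \<open>Working with representatives in [0,1] x C merges the apex cases: at a = 0 the weight min
  a b kills d, and b remains.\<close>

lemma D_cone_proj:
  assumes "a \<in> {0..1}" "b \<in> {0..1}" "c \<in> C" "c' \<in> C"
  shows "D (cone_proj (a, c)) (cone_proj (b, c')) = \<bar>a - b\<bar> + min a b * d c c'"
  using assms by (auto simp: D_simps cone_proj_def)

text \<open>The diameter bound enters here: passing through a smaller radius \<open>e\<close> costs an extra
  \<open>2 (min a b - e)\<close>, which pays for \<open>(min a b - e) * d c c'\<close>.\<close>

lemma cone_triangle_formula:
  assumes "0 \<le> a" "0 \<le> b" "0 \<le> e" "c \<in> C" "c' \<in> C" "c'' \<in> C"
  shows "\<bar>a - b\<bar> + min a b * d c c' \<le>
    (\<bar>a - e\<bar> + min a e * d c c'') + (\<bar>e - b\<bar> + min e b * d c'' c')"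
proof (cases "e < min a b")
  case True
  have "e * d c c' \<le> e * (d c c'' + d c'' c')"
    using assms triangle by (intro mult_left_mono) auto
  moreover have "(min a b - e) * d c c' \<le> (min a b - e) * 2"
    using assms True diam_le_2 by (intro mult_left_mono) auto
  ultimately have "min a b * d c c' \<le> e * d c c'' + e * d c'' c' + 2 * (min a b - e)"
    by (simp add: algebra_simps)
  moreover have "\<bar>a - b\<bar> + 2 * (min a b - e) = \<bar>a - e\<bar> + \<bar>e - b\<bar>" "min a e = e" "min e b = e"
    using True by auto
  ultimately show ?thesis
    by simp
next
  case False
  have "min a b * d c c' \<le> min a b * (d c c'' + d c'' c')"
    using assms triangle by (intro mult_left_mono) auto
  also have "\<dots> = min a b * d c c'' + min a b * d c'' c'"
    by (simp add: algebra_simps)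
  also have "\<dots> \<le> min a e * d c c'' + min e b * d c'' c'"
    using False by (intro add_mono mult_right_mono) auto
  finally show ?thesis
    using abs_triangle_ineq[of "a - e" "e - b"] by simp
qed

text \<open>The given c is a dummy second coordinate for the apex, which has representatives only if
  C is nonempty.\<close>

lemma ex_cone_proj:
  assumes "x \<in> X" "c \<in> C"
  obtains a c' where "a \<in> {0..1}" "c' \<in> C" "x = cone_proj (a, c')"
proof (cases x)
  case Apex
  with assms show ?thesis
    by (intro that[of 0 c]) simp_all
next
  case (Pt a c')
  with assms show ?thesis
    by (intro that[of a c']) simp_all
qed

lemma Metric_space_cone: "Metric_space X D"
proof
  show "0 \<le> D x y" for x y
    by (cases x; cases y) (auto simp: cone_dist_def)
  show "D x y = D y x" for x y
    by (cases x; cases y) (auto simp: cone_dist_def commute min.commute)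
  show "D x y = 0 \<longleftrightarrow> x = y" if "x \<in> X" "y \<in> X" for x y
  proof (cases x; cases y)
    fix a c b c'
    assume xy: "x = Pt a c" "y = Pt b c'"
    then have "0 \<le> min a b * d c c'"
      using that by simp
    \<comment> \<open>Both radii are positive, so vanishing of the second summand forces d c c' =
      0.\<close>
    then have "D x y = 0 \<longleftrightarrow> \<bar>a - b\<bar> = 0 \<and> min a b * d c c' = 0"
      using that xy by (simp add: D_simps add_nonneg_eq_0_iff)
    then show ?thesis
      using that xy by auto
  qed (use that in \<open>auto simp: D_simps\<close>)
  show "D x z \<le> D x y + D y z" if "x \<in> X" "y \<in> X" "z \<in> X" for x y z
  proof (cases "C = {}")
    case True
    then have "X = {Apex}"
      by (auto simp: cone_space_def)
    then show ?thesis
      using that by (simp add: D_simps)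
  next
    case False
    then obtain c where "c \<in> C"
      by blast
    from that(1) this obtain a1 c1 where 1: "a1 \<in> {0..1}" "c1 \<in> C" "x = cone_proj (a1, c1)"
      by (rule ex_cone_proj)
    from that(2) \<open>c \<in> C\<close> obtain a2 c2 where 2: "a2 \<in> {0..1}" "c2 \<in> C" "y = cone_proj (a2, c2)"
      by (rule ex_cone_proj)
    from that(3) \<open>c \<in> C\<close> obtain a3 c3 where 3: "a3 \<in> {0..1}" "c3 \<in> C" "z = cone_proj (a3, c3)"
      by (rule ex_cone_proj)
    show ?thesis
      using 1 2 3 cone_triangle_formula[of a1 a3 a2 c1 c3 c2]
      by (simp add: D_cone_proj)
  qed
qed

sublocale cone: Metric_space X D
  by (rule Metric_space_cone)

section \<open>The linear dilation family\<close>

text \<open>Two scalings of one point lie on the same ray, so d contributes nothing and only the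
  difference of radii counts. Linearity of the family and its limit at 1 are both read off from
  this.\<close>

lemma D_cone_scaling:
  assumes "x \<in> X" "\<alpha> \<in> {0..1}" "\<beta> \<in> {0..1}"
  shows "D (cone_scaling \<alpha> x) (cone_scaling \<beta> x) = \<bar>\<alpha> - \<beta>\<bar> * D x Apex"
proof (cases x)
  case Apex
  then show ?thesis
    by (simp add: D_simps)
next
  case (Pt a c)
  then have a: "0 < a" "a \<le> 1" "c \<in> C"
    using assms by auto
  have "\<bar>a * \<alpha> - a * \<beta>\<bar> = a * \<bar>\<alpha> - \<beta>\<bar>"
    using a by (simp add: abs_mult flip: right_diff_distrib)
  then show ?thesis
    using Pt a assms by (auto simp: D_simps mult_le_one)
qed

lemma cone_scaling_in_X: "x \<in> X \<Longrightarrow> \<alpha> \<in> {0..1} \<Longrightarrow> cone_scaling \<alpha> x \<in> X"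
  by (cases x) (auto intro: mult_le_one)

text \<open>The formula is homogeneous of degree one in the pair of radii.\<close>

lemma dilation_cone_scaling:
  assumes "\<alpha> \<in> {0..1}"
  shows "dilation X D X D \<alpha> (cone_scaling \<alpha>)"
proof -
  have "D (cone_scaling \<alpha> x) (cone_scaling \<alpha> y) = \<alpha> * D x y" if "x \<in> X" "y \<in> X" for x y
  proof (cases x; cases y)
    fix a c b c'
    assume xy: "x = Pt a c" "y = Pt b c'"
    have "\<bar>a * \<alpha> - b * \<alpha>\<bar> = \<alpha> * \<bar>a - b\<bar>" "min (a * \<alpha>) (b * \<alpha>) = \<alpha> * min a b"
      using assms by (simp_all add: abs_mult min_mult_distrib_left mult.commute[of _ \<alpha>]
          flip: right_diff_distrib)
    then show ?thesis
      using that xy assms by (auto simp: D_simps mult_le_one algebra_simps)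
  qed (use that assms in \<open>auto simp: D_simps mult_le_one\<close>)
  then show ?thesis
    using assms cone_scaling_in_X by (auto simp: dilation_def)
qed

text \<open>Scaling by 1 is the identity and radii are at most 1, so the point scaled by \<alpha> is
  within |\<alpha> - 1| of x.\<close>

lemma limitin_cone_scaling:
  assumes "x \<in> X"
  shows "limitin cone.mtopology (\<lambda>\<alpha>. cone_scaling \<alpha> x) x (at 1 within {0..1})"
  unfolding cone.limitin_metric
proof (intro conjI allI impI)
  fix \<epsilon> :: real
  assume "\<epsilon> > 0"
  have x1: "cone_scaling 1 x = x"
    by (cases x) simp_all
  have "D x Apex \<le> 1"
    using assms by (cases x) (auto simp: D_simps)
  then have le: "\<bar>\<alpha> - 1\<bar> * D x Apex \<le> \<bar>\<alpha> - 1\<bar>" for \<alpha>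
    by (simp add: mult_left_le)
  have "cone_scaling \<alpha> x \<in> X \<and> D (cone_scaling \<alpha> x) x < \<epsilon>"
    if "\<alpha> \<in> {0..1}" "dist \<alpha> 1 < \<epsilon>" for \<alpha>
    using that assms cone_scaling_in_X D_cone_scaling[of x \<alpha> 1] le[of \<alpha>] x1
    by (simp add: dist_real_def)
  then show "\<forall>\<^sub>F \<alpha> in at 1 within {0..1}. cone_scaling \<alpha> x \<in> X \<and> D (cone_scaling \<alpha> x) x < \<epsilon>"
    using \<open>\<epsilon> > 0\<close> by (auto simp: eventually_at)
qed (fact assms)

lemma linear_dilation_family_cone_scaling:
  "linear_dilation_family X D Apex {0..1} cone_scaling"
proof -
  have "cone_scaling \<alpha> (cone_scaling \<beta> x) = cone_scaling (\<alpha> * \<beta>) x" for \<alpha> \<beta> and x :: "'c cone_point"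
    by (cases x) (simp_all add: mult_ac)
  then have "dilation_family X D Apex {0..1} cone_scaling"
    unfolding dilation_family_def
    using Metric_space_cone dilation_cone_scaling
    by (auto intro: mult_le_one limitin_cone_scaling)
  moreover have "D (cone_scaling \<alpha> x) (cone_scaling \<gamma> x) =
      D (cone_scaling \<alpha> x) (cone_scaling \<beta> x) + D (cone_scaling \<beta> x) (cone_scaling \<gamma> x)"
    if "\<alpha> \<in> {0..1}" "\<beta> \<in> {0..1}" "\<gamma> \<in> {0..1}" "\<alpha> \<le> \<beta>" "\<beta> \<le> \<gamma>" "x \<in> X" for \<alpha> \<beta> \<gamma> x
  proof -
    have "\<bar>\<alpha> - \<gamma>\<bar> = \<bar>\<alpha> - \<beta>\<bar> + \<bar>\<beta> - \<gamma>\<bar>"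
      using that by simp
    then show ?thesis
      using that by (simp add: D_cone_scaling algebra_simps)
  qed
  ultimately show ?thesis
    unfolding linear_dilation_family_def by blast
qed

section \<open>The metric topology is the cone topology\<close>

text \<open>This is continuity of \<open>cone_proj\<close>: as min a b is at most 1, D is bounded by
  |a - b| + d c c', so half of the radius is allotted to each coordinate.\<close>

lemma openin_preimage_cone_proj:
  assumes "openin cone.mtopology U"
  shows "openin (prod_topology (top_of_set {0..1}) mtopology) {z \<in> {0..1} \<times> C. cone_proj z \<in> U}"
  unfolding openin_prod_topology_alt
proof (intro allI impI)
  fix a c
  assume "(a, c) \<in> {z \<in> {0..1} \<times> C. cone_proj z \<in> U}"
  then have a: "a \<in> {0..1}" and c: "c \<in> C" and U: "cone_proj (a, c) \<in> U"
    by auto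
  obtain r where "r > 0" and r: "cone.mball (cone_proj (a, c)) r \<subseteq> U"
    using assms U cone.openin_mtopology by blast
  have "cone_proj (b, c') \<in> U"
    if b: "b \<in> {0..1}" "\<bar>a - b\<bar> < r / 2" and c': "c' \<in> mball c (r / 2)" for b c'
  proof -
    have "min a b * d c c' \<le> d c c'"
      using a by (intro mult_left_le_one_le) (use b in auto)
    then have "D (cone_proj (a, c)) (cone_proj (b, c')) < r"
      using a b c c' D_cone_proj[of a b c c'] by auto
    then show ?thesis
      using r a b c c' cone_proj_in_cone_space[of _ "{0..1}" _ C] by (auto simp: subset_iff)
  qed
  then show "\<exists>V W. openin (top_of_set {0..1}) V \<and> openin mtopology W \<and> a \<in> V \<and> c \<in> W \<and>
      V \<times> W \<subseteq> {z \<in> {0..1} \<times> C. cone_proj z \<in> U}"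
    using a c \<open>r > 0\<close>
    by (intro exI[of _ "{0..1} \<inter> ball a (r / 2)"] exI[of _ "mball c (r / 2)"])
      (auto simp: dist_real_def openin_open_Int)
qed

text \<open>Membership depends on the radius alone, uniformly in C, exactly as in the apex condition
  of \<open>cone_topology\<close>.\<close>

lemma mball_Apex_iff: "r > 0 \<Longrightarrow> x \<in> cone.mball Apex r \<longleftrightarrow> x = Apex \<or> (\<exists>a c. x = Pt a c \<and> x \<in> X \<and> a < r)"
  by (cases x) (auto simp: D_simps)

text \<open>At the apex this is the extra condition of \<open>cone_topology\<close>. At radius a > 0
  a product neighbourhood is available, and a small D-distance bounds d because the weight min a b
  stays away from 0.\<close>

lemma mball_subset_of_openin_cone_topology:
  assumes U: "openin (cone_topology {0..1} mtopology) U" and "x \<in> U"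
  shows "\<exists>r>0. cone.mball x r \<subseteq> U"
proof (cases x)
  case Apex
  then obtain e where "e > 0"
    and "\<forall>a\<in>{0..1} - {0}. \<forall>c\<in>C. \<bar>a\<bar> < e \<longrightarrow> Pt a c \<in> U"
    using assms by (auto simp: openin_cone_topology)
  then show ?thesis
    using Apex \<open>x \<in> U\<close> by (intro exI[of _ e]) (auto simp: mball_Apex_iff subset_iff simp del: cone.in_mball)
next
  case (Pt a c)
  then have a: "0 < a" "a \<le> 1" and c: "c \<in> C"
    using assms by (auto simp: openin_cone_topology)
  have "openin (prod_topology (top_of_set {0..1}) mtopology) {z \<in> {0..1} \<times> C. cone_proj z \<in> U}"
    using U by (simp add: openin_cone_topology)
  moreover have "(a, c) \<in> {z \<in> {0..1} \<times> C. cone_proj z \<in> U}"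
    using a c Pt \<open>x \<in> U\<close> by simp
  ultimately obtain V W where V: "openin (top_of_set {0..1}) V" "a \<in> V"
    and W: "openin mtopology W" "c \<in> W"
    and VW: "V \<times> W \<subseteq> {z \<in> {0..1} \<times> C. cone_proj z \<in> U}"
    unfolding openin_prod_topology_alt by meson
  obtain e where "e > 0" and e: "\<And>b. b \<in> {0..1} \<Longrightarrow> dist b a < e \<Longrightarrow> b \<in> V"
    using V unfolding openin_euclidean_subtopology_iff by metis
  obtain e' where "e' > 0" and e': "mball c e' \<subseteq> W"
    using W openin_mtopology by blast
  \<comment> \<open>The bound e keeps the radius in V. The bound a / 2 excludes the apex, which is
    at distance a, and makes min a b at least a / 2. The last bound then yields d c c' < e' after
    cancelling a / 2.\<close>
  define r where "r = Min {e, a / 2, a / 2 * e'}"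
  have r: "r > 0" "r \<le> e" "r \<le> a / 2" "r \<le> a / 2 * e'"
    using a \<open>e > 0\<close> \<open>e' > 0\<close> by (auto simp: r_def)
  have "y \<in> U" if y: "y \<in> cone.mball x r" for y
  proof (cases y)
    case Apex
    then have "a < r"
      using y Pt by (auto simp: D_simps)
    then show ?thesis
      using r a by simp
  next
    case (Pt b c')
    have x: "x = Pt a c" "x \<in> X"
      using y \<open>x = Pt a c\<close> by auto
    have b: "0 < b" "b \<le> 1" "c' \<in> C"
      using Pt y by auto
    have D: "\<bar>a - b\<bar> + min a b * d c c' < r"
      using Pt x y by (auto simp: D_simps)
    have "0 \<le> min a b * d c c'"
      using a b by simp
    with D have ab: "\<bar>a - b\<bar> < r"
      by linarith
    then have "a / 2 \<le> min a b"
      using r a by auto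
    then have "a / 2 * d c c' \<le> min a b * d c c'"
      by (intro mult_right_mono) auto
    with D r have "a / 2 * d c c' < a / 2 * e'"
      by linarith
    then have "d c c' < e'"
      using a by simp
    then have "(b, c') \<in> V \<times> W"
      using e[of b] e' b c ab r by (auto simp: dist_real_def abs_minus_commute subset_iff)
    then show ?thesis
      using VW Pt b by auto
  qed
  with r show ?thesis
    by blast
qed

lemma mtopology_cone: "cone.mtopology = cone_topology {0..1} mtopology"
  unfolding topology_eq
proof (intro allI iffI)
  fix U
  assume U: "openin cone.mtopology U"
  have "\<exists>e>0. \<forall>a\<in>{0..1} - {0}. \<forall>c\<in>C. \<bar>a\<bar> < e \<longrightarrow> Pt a c \<in> U" if "Apex \<in> U"
  proof -
    obtain e where "e > 0" "cone.mball Apex e \<subseteq> U"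
      using U \<open>Apex \<in> U\<close> unfolding cone.openin_mtopology by meson
    then show ?thesis
      by (intro exI[of _ e]) (auto simp: mball_Apex_iff subset_iff simp del: cone.in_mball)
  qed
  then show "openin (cone_topology {0..1} mtopology) U"
    using U openin_preimage_cone_proj[OF U] openin_subset[OF U]
    by (simp add: openin_cone_topology)
next
  fix U
  assume U: "openin (cone_topology {0..1} mtopology) U"
  then have "U \<subseteq> X"
    by (simp add: openin_cone_topology)
  then show "openin cone.mtopology U"
    using mball_subset_of_openin_cone_topology[OF U] by (auto simp: cone.openin_mtopology)
qed

text \<open>This confirms that for compact C the topology is the usual quotient. Nonemptiness of C
  makes \<open>cone_proj\<close> reach the apex.\<close>

lemma quotient_map_cone_proj:
  assumes "C \<noteq> {}" "compact_space mtopology"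
  shows "quotient_map (prod_topology (top_of_set {0..1}) mtopology) cone.mtopology cone_proj"
  unfolding quotient_map_def
proof (intro conjI allI impI)
  show "cone_proj ` topspace (prod_topology (top_of_set {0..1}) mtopology) = topspace cone.mtopology"
    using assms by (simp add: image_cone_proj)
  fix U
  assume "U \<subseteq> topspace cone.mtopology"
  then have "U \<subseteq> X"
    by simp
  then show "openin (prod_topology (top_of_set {0..1}) mtopology)
      {z \<in> topspace (prod_topology (top_of_set {0..1}) mtopology). cone_proj z \<in> U} \<longleftrightarrow>
      openin cone.mtopology U"
    using small_of_open_preimage_cone_proj[of mtopology "{0..1}" U] assms
    by (auto simp: mtopology_cone openin_cone_topology)
qed

section \<open>The boundary of the unit ball\<close>

text \<open>Every x is the limit of its scalings by \<alpha> < 1, which lie in the open ball, so the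
  closure is the whole cone. The ball is its own interior, and its complement is the set of points
  of radius 1.\<close>

lemma frontier_of_mball_Apex: "cone.mtopology frontier_of cone.mball Apex 1 = {Pt 1 c |c. c \<in> C}"
proof -
  let ?B = "cone.mball Apex 1"
  have "x \<in> cone.mtopology closure_of ?B" if x: "x \<in> X" for x
    unfolding cone.metric_closure_of
  proof (intro CollectI conjI allI impI)
    fix r :: real
    assume "r > 0"
    have lim: "\<forall>\<^sub>F \<alpha> in at 1 within {0..1}. cone_scaling \<alpha> x \<in> X \<and> D (cone_scaling \<alpha> x) x < r"
      using limitin_cone_scaling[OF x] \<open>r > 0\<close> by (simp add: cone.limitin_metric)
    then obtain \<delta> where "\<delta> > 0"
      and \<delta>: "\<And>\<alpha>. \<alpha> \<in> {0..1} \<Longrightarrow> \<alpha> \<noteq> 1 \<Longrightarrow> dist \<alpha> 1 < \<delta> \<Longrightarrow> D (cone_scaling \<alpha> x) x < r"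
      unfolding eventually_at by blast
    \<comment> \<open>Halving \<delta> makes the distance to 1 strictly less than \<delta>; the
      maximum with 0 keeps \<alpha> in [0,1] when \<delta> is large.\<close>
    define \<alpha> where "\<alpha> = max 0 (1 - \<delta> / 2)"
    have \<alpha>: "\<alpha> \<in> {0..1}" "\<alpha> < 1" "dist \<alpha> 1 < \<delta>"
      using \<open>\<delta> > 0\<close> by (auto simp: \<alpha>_def dist_real_def)
    have "D (cone_scaling \<alpha> x) x < r"
      using \<alpha> by (intro \<delta>) auto
    moreover have "D Apex (cone_scaling \<alpha> x) < 1"
    proof (cases x)
      case (Pt a c)
      then have "0 < a" "a \<le> 1" "c \<in> C"
        using x by auto
      then have "a * \<alpha> < 1"
        using \<alpha> mult_left_le_one_le[of \<alpha> a] by auto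
      then show ?thesis
        using Pt \<alpha> \<open>0 < a\<close> \<open>c \<in> C\<close> by (auto simp: D_simps)
    qed (simp add: D_simps)
    ultimately show "\<exists>y\<in>?B. y \<in> cone.mball x r"
      using x \<alpha> cone_scaling_in_X[of x \<alpha>] cone.commute
      by (intro bexI[of _ "cone_scaling \<alpha> x"]) auto
  qed (fact x)
  then have "cone.mtopology closure_of ?B = X"
    using closure_of_subset_topspace[of cone.mtopology ?B] by auto
  moreover have "cone.mtopology interior_of ?B = ?B"
    by (simp add: interior_of_openin)
  moreover have "X - ?B = {Pt 1 c |c. c \<in> C}"
  proof (rule set_eqI)
    show "x \<in> X - ?B \<longleftrightarrow> x \<in> {Pt 1 c |c. c \<in> C}" for x
      by (cases x) (auto simp: D_simps)
  qed
  ultimately show ?thesis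
    by (simp add: frontier_of_def)
qed

end

theorem proposition2p7:
  fixes C :: "'c set" and d :: "'c \<Rightarrow> 'c \<Rightarrow> real"
  assumes "Metric_space C d" and "mdiameter C d \<le> 2"
  shows "Metric_space (cone_space {0..1} C) (cone_dist C d) \<and>
    Metric_space.mtopology (cone_space {0..1} C) (cone_dist C d) =
      cone_topology {0..1} (Metric_space.mtopology C d) \<and>
    (C \<noteq> {} \<and> compact_space (Metric_space.mtopology C d) \<longrightarrow>
      quotient_map (prod_topology (top_of_set {0..1}) (Metric_space.mtopology C d))
        (Metric_space.mtopology (cone_space {0..1} C) (cone_dist C d)) cone_proj) \<and>
    linear_dilation_family (cone_space {0..1} C) (cone_dist C d) Apex {0..1} cone_scaling \<and>
    cone_topology {0..1} (Metric_space.mtopology C d) frontier_of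
      Metric_space.mball (cone_space {0..1} C) (cone_dist C d) Apex 1 = {Pt 1 c |c. c \<in> C}"
proof -
  have "\<forall>x\<in>C. \<forall>y\<in>C. d x y \<le> 2"
    using assms(2) mdiameter_le_iff[of 2 C d] by simp
  then interpret cone_over_metric C d
    using assms(1) by (simp add: cone_over_metric_def cone_over_metric_axioms_def)
  show ?thesis
    using Metric_space_cone mtopology_cone quotient_map_cone_proj
      linear_dilation_family_cone_scaling frontier_of_mball_Apex
    by simp
qed

end
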